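(* Let $\mathcal{H}$ be a nonzero complex Hilbert space, let $S$ and $T$ be bilateral operator valued weighted shifts on $\mathcal{H}$ with operator weights $\{S_n\}_{n\in\mathbb{Z}}$ and $\{T_n\}_{n\in\mathbb{Z}}$, respectively, and let $m\in\mathbb{Z}$ be such that $S_{m+n}$, $T_n$, $S_{m-n-1}^*$ and $T_{-n-1}^*$ have dense ranges for all $n\in\mathbb{N}$. Then the following are equivalent: (i) there exists a unitary operator $U\in \boldsymbol{B}(\ell_2(\mathbb{Z},\mathcal{H}))$ of diagonal form such that $US=TU$ and $U_{0,m}\neq 0$; (ii) there exists a unitary operator $V\in\boldsymbol{B}(\mathcal{H})$ such that both of the following hold: (a) $\|S_{m+n-1}\cdots S_m x\| = \|T_{n-1}\cdots T_0 V x\|$ for all $x\in\mathcal{H}$ and all $n\in\mathbb{N}_+$, (b) $\|S_{m-n}^*\cdots S_{m-1}^* x\| = \|T_{-n}^*\cdots T_{-1}^* V x\|$ for all $x\in\mathcal{H}$ and all $n\in\mathbb{N}_+$.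
   Context: $\mathbb{N}$ is the set of non-negative integers and $\mathbb{N}_+$ the set of positive integers. $\boldsymbol{B}(\mathcal{K})$ is the algebra of bounded linear operators on a Hilbert space $\mathcal{K}$. $\ell_2(\mathbb{Z},\mathcal{H})=\bigoplus_{n\in\mathbb{Z}}\mathcal{H}$ is the Hilbert space of two-sided sequences $x=(x_n)_{n\in\mathbb{Z}}$ in $\mathcal{H}$ with $\sum_{n}\|x_n\|^2<\infty$ and inner product $\langle x,y\rangle=\sum_n\langle x_n,y_n\rangle$. Every $U\in\boldsymbol{B}(\ell_2(\mathbb{Z},\mathcal{H}))$ is identified with its operator matrix $[U_{i,j}]_{i,j\in\mathbb{Z}}$, $U_{i,j}\in\boldsymbol{B}(\mathcal{H})$, where $(Ux)_i=\sum_j U_{i,j}x_j$. Bilateral operator valued weighted shift: given a two-sided sequence $\{S_n\}_{n\in\mathbb{Z}}\subseteq\boldsymbol{B}(\mathcal{H})$ of nonzero operators with $\{\|S_n\|\}_{n\in\mathbb{Z}}$ bounded, it is the operator $S\in\boldsymbol{B}(\ell_2(\mathbb{Z},\mathcal{H}))$ defined by $(Sx)_n=S_n x_{n-1}$, $n\in\mathbb{Z}$; the $S_n$ are its weights. Diagonal operator: an operator $D\in\boldsymbol{B}(\ell_2(\mathbb{Z},\mathcal{H}))$ with $(Dx)_n=D_nx_n$ for some $\{D_n\}_{n\in\mathbb{Z}}\subseteq\boldsymbol{B}(\mathcal{H})$ with $\{\|D_n\|\}_{n\in\mathbb{Z}}$ bounded. Let $F$ be the unitary bilateral operator valued weighted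 shift all of whose weights are the identity on $\mathcal{H}$. An operator is of diagonal form if it equals $F^kD$ for some $k\in\mathbb{Z}$ and some diagonal operator $D$. *)

theory Defs
  imports "HOL-Analysis.Analysis"
begin

section \<open>Complex Hilbert spaces\<close>

text \<open>
  The norm and the topology are those of \<^class>\<open>real_inner\<close>, whose real inner product is required
  to be the real part of the complex one; hence \<open>norm x = sqrt (Re (cinner x x))\<close>.  The complex
  inner product is linear in its first argument.
\<close>

class complex_inner = real_inner +
  fixes scaleC :: "complex \<Rightarrow> 'a \<Rightarrow> 'a"  (infixr \<open>*\<^sub>C\<close> 75)
    and cinner :: "'a \<Rightarrow> 'a \<Rightarrow> complex"
  assumes scaleC_add_right: "c *\<^sub>C (x + y) = c *\<^sub>C x + c *\<^sub>C y"
    and scaleC_add_left: "(c + d) *\<^sub>C x = c *\<^sub>C x + d *\<^sub>C x"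
    and scaleC_scaleC: "c *\<^sub>C d *\<^sub>C x = (c * d) *\<^sub>C x"
    and scaleC_of_real: "complex_of_real r *\<^sub>C x = r *\<^sub>R x"
    and cinner_commute: "cinner x y = cnj (cinner y x)"
    and cinner_add_left: "cinner (x + y) z = cinner x z + cinner y z"
    and cinner_scaleC_left: "cinner (c *\<^sub>C x) y = c * cinner x y"
    and Re_cinner: "Re (cinner x y) = inner x y"

class complex_hilbert = complex_inner + complete_space

instantiation complex :: complex_hilbert
begin
definition scaleC_complex :: "complex \<Rightarrow> complex \<Rightarrow> complex" where "scaleC_complex c x = c * x"
definition cinner_complex :: "complex \<Rightarrow> complex \<Rightarrow> complex" where "cinner_complex x y = x * cnj y"
instance
  by standard
    (auto simp: scaleC_complex_def cinner_complex_def inner_complex_def scaleR_conv_of_real algebra_simps)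
end

lemma cinner_self: "cinner x x = complex_of_real ((norm x)\<^sup>2)"
proof -
  have "Im (cinner x x) = 0"
    using arg_cong[OF cinner_commute[of x x], of Im] by simp
  then show ?thesis
    by (simp add: complex_eq_iff Re_cinner power2_norm_eq_inner)
qed

lemma norm_scaleC: "norm (c *\<^sub>C x) = cmod c * norm (x::'a::complex_inner)"
proof -
  have "cinner x (c *\<^sub>C x) = cnj (cinner (c *\<^sub>C x) x)"
    by (rule cinner_commute)
  then have "cinner (c *\<^sub>C x) (c *\<^sub>C x) = c * cnj c * cinner x x"
    by (subst cinner_scaleC_left) (simp add: cinner_scaleC_left cinner_self del: of_real_power)
  then have "complex_of_real ((norm (c *\<^sub>C x))\<^sup>2) = complex_of_real ((cmod c * norm x)\<^sup>2)"
    by (simp only: cinner_self complex_norm_square[symmetric] power_mult_distrib of_real_mult of_real_power)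
  then have "(norm (c *\<^sub>C x))\<^sup>2 = (cmod c * norm x)\<^sup>2"
    by (simp only: of_real_eq_iff)
  then show ?thesis
    by (simp add: power2_eq_iff_nonneg)
qed

lemma cinner_Cauchy_Schwarz: "cmod (cinner x y) \<le> norm x * norm y"
proof (cases "cinner x y = 0")
  case False
  define c where "c = cnj (cinner x y) / cmod (cinner x y)"
  have c1: "cmod c = 1"
    using False by (simp add: c_def norm_divide)
  have "c * cinner x y = cmod (cinner x y)"
    using False by (simp add: c_def mult.commute complex_norm_square[symmetric] power2_eq_square)
  then have "inner (c *\<^sub>C x) y = cmod (cinner x y)"
    by (metis Re_cinner Re_complex_of_real cinner_scaleC_left)
  then show ?thesis
    using norm_cauchy_schwarz[of "c *\<^sub>C x" y] by (simp add: norm_scaleC c1)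
qed simp

section \<open>Bounded operators\<close>

definition bounded_clinear :: "('a::complex_inner \<Rightarrow> 'b::complex_inner) \<Rightarrow> bool" where
  "bounded_clinear A \<longleftrightarrow> bounded_linear A \<and> (\<forall>c x. A (c *\<^sub>C x) = c *\<^sub>C A x)"

text \<open>For bounded \<open>A\<close> between Hilbert spaces the described \<open>B\<close> exists and is unique by Riesz representation.\<close>

definition cadjoint :: "('a::complex_hilbert \<Rightarrow> 'b::complex_hilbert) \<Rightarrow> 'b \<Rightarrow> 'a" where
  "cadjoint A = (THE B. \<forall>x y. cinner (A x) y = cinner x (B y))"

definition unitary_op :: "('a::complex_hilbert \<Rightarrow> 'a) \<Rightarrow> bool" where
  "unitary_op U \<longleftrightarrow> bounded_clinear U \<and> cadjoint U \<circ> U = id \<and> U \<circ> cadjoint U = id"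

definition dense_range :: "('a::complex_hilbert \<Rightarrow> 'a) \<Rightarrow> bool" where
  "dense_range A \<longleftrightarrow> closure (range A) = UNIV"

definition bounded_op_family :: "(int \<Rightarrow> 'a::complex_inner \<Rightarrow> 'a) \<Rightarrow> bool" where
  "bounded_op_family W \<longleftrightarrow> (\<forall>n. bounded_clinear (W n)) \<and> bdd_above (range (\<lambda>n. onorm (W n)))"

section \<open>The space of square-summable two-sided sequences\<close>

typedef (overloaded) 'a ell2 = "{x :: int \<Rightarrow> 'a::complex_inner. (\<lambda>n. (norm (x n))\<^sup>2) summable_on UNIV}"
  morphisms ell2_nth Abs_ell2
  by (rule exI[of _ "\<lambda>_. 0"]) simp

setup_lifting type_definition_ell2

lemma ell2_eqI: "(\<And>n. ell2_nth x n = ell2_nth y n) \<Longrightarrow> x = y"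
  by transfer auto

lemma ell2_summable: "(\<lambda>n. (norm (ell2_nth x n))\<^sup>2) summable_on UNIV"
  using ell2_nth by blast

lemma norm_add_square_le: "(norm (a + b))\<^sup>2 \<le> 2 * (norm a)\<^sup>2 + 2 * (norm (b::'a::real_normed_vector))\<^sup>2"
proof -
  have "(norm (a + b))\<^sup>2 \<le> (norm a + norm b)\<^sup>2"
    by (simp add: norm_triangle_ineq power_mono)
  also have "\<dots> \<le> 2 * (norm a)\<^sup>2 + 2 * (norm b)\<^sup>2"
    using zero_le_power2[of "norm a - norm b"] by (simp add: power2_eq_square algebra_simps)
  finally show ?thesis .
qed

lemma ell2_add_closed:
  assumes "(\<lambda>n. (norm (x n))\<^sup>2) summable_on A" "(\<lambda>n. (norm (y n))\<^sup>2) summable_on A"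
  shows "(\<lambda>n. (norm (x n + y n :: 'a::real_normed_vector))\<^sup>2) summable_on A"
proof (rule summable_on_comparison_test)
  show "(\<lambda>n. 2 * (norm (x n))\<^sup>2 + 2 * (norm (y n))\<^sup>2) summable_on A"
    using assms by (intro summable_on_add summable_on_cmult_right)
qed (auto simp: norm_add_square_le)

instantiation ell2 :: (complex_inner) complex_inner
begin

lift_definition zero_ell2 :: "'a ell2" is "\<lambda>_. 0" by simp

lift_definition plus_ell2 :: "'a ell2 \<Rightarrow> 'a ell2 \<Rightarrow> 'a ell2" is "\<lambda>x y n. x n + y n"
  by (rule ell2_add_closed)

lift_definition uminus_ell2 :: "'a ell2 \<Rightarrow> 'a ell2" is "\<lambda>x n. - x n" by simp

lift_definition minus_ell2 :: "'a ell2 \<Rightarrow> 'a ell2 \<Rightarrow> 'a ell2" is "\<lambda>x y n. x n - y n"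
  subgoal for x y using ell2_add_closed[of x UNIV "\<lambda>n. - y n"] by simp
  done

lift_definition scaleR_ell2 :: "real \<Rightarrow> 'a ell2 \<Rightarrow> 'a ell2" is "\<lambda>r x n. r *\<^sub>R x n"
  by (simp add: power_mult_distrib summable_on_cmult_right)

lift_definition scaleC_ell2 :: "complex \<Rightarrow> 'a ell2 \<Rightarrow> 'a ell2" is "\<lambda>c x n. c *\<^sub>C x n"
  by (simp add: norm_scaleC power_mult_distrib summable_on_cmult_right)

definition cinner_ell2 :: "'a ell2 \<Rightarrow> 'a ell2 \<Rightarrow> complex" where
  "cinner_ell2 x y = (\<Sum>\<^sub>\<infinity>n\<in>UNIV. cinner (ell2_nth x n) (ell2_nth y n))"

definition inner_ell2 :: "'a ell2 \<Rightarrow> 'a ell2 \<Rightarrow> real" where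
  "inner_ell2 x y = Re (cinner x y)"

definition norm_ell2 :: "'a ell2 \<Rightarrow> real" where
  "norm_ell2 x = sqrt (inner x x)"

definition dist_ell2 :: "'a ell2 \<Rightarrow> 'a ell2 \<Rightarrow> real" where
  "dist_ell2 x y = norm (x - y)"

definition sgn_ell2 :: "'a ell2 \<Rightarrow> 'a ell2" where
  "sgn_ell2 x = inverse (norm x) *\<^sub>R x"

definition uniformity_ell2 :: "('a ell2 \<times> 'a ell2) filter" where
  "uniformity_ell2 = (INF e\<in>{0 <..}. principal {(x, y). dist x y < e})"

definition open_ell2 :: "'a ell2 set \<Rightarrow> bool" where
  "open_ell2 X = (\<forall>x\<in>X. eventually (\<lambda>(x', y). x' = x \<longrightarrow> y \<in> X) uniformity)"

lemma cinner_summable: "(\<lambda>n. cinner (ell2_nth x n) (ell2_nth (y::'a ell2) n)) summable_on UNIV"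
proof (rule abs_summable_summable, rule summable_on_comparison_test)
  show "(\<lambda>n. (norm (ell2_nth x n))\<^sup>2 + (norm (ell2_nth y n))\<^sup>2) summable_on UNIV"
    by (intro summable_on_add ell2_summable)
  fix n
  have "a * b \<le> a\<^sup>2 + b\<^sup>2" if "a \<ge> 0" "b \<ge> 0" for a b :: real
    using zero_le_power2[of "a - b"] mult_nonneg_nonneg[OF that]
    by (simp add: power2_eq_square algebra_simps)
  then show "norm (cinner (ell2_nth x n) (ell2_nth y n))
      \<le> (norm (ell2_nth x n))\<^sup>2 + (norm (ell2_nth y n))\<^sup>2"
    by (rule order_trans[OF cinner_Cauchy_Schwarz]) auto
qed auto

lemma inner_ell2_conv: "inner x (y::'a ell2) = (\<Sum>\<^sub>\<infinity>n\<in>UNIV. inner (ell2_nth x n) (ell2_nth y n))"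
  unfolding inner_ell2_def cinner_ell2_def
  by (subst infsum_Re[OF cinner_summable, symmetric]) (simp add: Re_cinner)

lemma inner_summable: "(\<lambda>n. inner (ell2_nth x n) (ell2_nth (y::'a ell2) n)) summable_on UNIV"
  using summable_on_Re[OF cinner_summable[of x y]] by (simp add: Re_cinner)

instance
proof
  fix x y z :: "'a ell2" and a b :: real and c d :: complex
  show "x + y + z = x + (y + z)" by transfer (simp add: add.assoc)
  show "x + y = y + x" by transfer (simp add: add.commute)
  show "0 + x = x" by transfer simp
  show "- x + x = 0" by transfer simp
  show "x - y = x + - y" by transfer simp
  show "a *\<^sub>R (x + y) = a *\<^sub>R x + a *\<^sub>R y" by transfer (simp add: scaleR_add_right)
  show "(a + b) *\<^sub>R x = a *\<^sub>R x + b *\<^sub>R x" by transfer (simp add: scaleR_add_left)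
  show "a *\<^sub>R b *\<^sub>R x = (a * b) *\<^sub>R x" by transfer simp
  show "1 *\<^sub>R x = x" by transfer simp
  show "sgn x = inverse (norm x) *\<^sub>R x" by (rule sgn_ell2_def)
  show "dist x y = norm (x - y)" by (rule dist_ell2_def)
  show "norm x = sqrt (inner x x)" by (rule norm_ell2_def)
  show "(uniformity :: ('a ell2 \<times> 'a ell2) filter) = (INF e\<in>{0 <..}. principal {(x, y). dist x y < e})"
    by (rule uniformity_ell2_def)
  show "open X = (\<forall>x\<in>X. \<forall>\<^sub>F (x', y) in uniformity. x' = x \<longrightarrow> y \<in> X)" for X :: "'a ell2 set"
    by (rule open_ell2_def)
  show "c *\<^sub>C (x + y) = c *\<^sub>C x + c *\<^sub>C y" by transfer (simp add: scaleC_add_right)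
  show "(c + d) *\<^sub>C x = c *\<^sub>C x + d *\<^sub>C x" by transfer (simp add: scaleC_add_left)
  show "c *\<^sub>C d *\<^sub>C x = (c * d) *\<^sub>C x" by transfer (simp add: scaleC_scaleC)
  show "complex_of_real a *\<^sub>C x = a *\<^sub>R x" by transfer (simp add: scaleC_of_real)
  show comm: "cinner x y = cnj (cinner y x)"
    unfolding cinner_ell2_def infsum_cnj[symmetric] by (simp add: cinner_commute[symmetric])
  show "cinner (x + y) z = cinner x z + cinner y z"
    unfolding cinner_ell2_def
    by (simp add: plus_ell2.rep_eq cinner_add_left infsum_add cinner_summable)
  show "cinner (c *\<^sub>C x) y = c * cinner x y"
    unfolding cinner_ell2_def
    by (simp add: scaleC_ell2.rep_eq cinner_scaleC_left infsum_cmult_right')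
  show "Re (cinner x y) = inner x y" by (simp add: inner_ell2_def)
  show "inner x y = inner y x" by (simp add: inner_ell2_conv inner_commute)
  show "inner (x + y) z = inner x z + inner y z"
    by (simp add: inner_ell2_conv plus_ell2.rep_eq inner_add_left infsum_add inner_summable)
  show "inner (a *\<^sub>R x) y = a * inner x y"
    by (simp add: inner_ell2_conv scaleR_ell2.rep_eq infsum_cmult_right')
  show "0 \<le> inner x x" by (simp add: inner_ell2_conv infsum_nonneg)
  show "inner x x = 0 \<longleftrightarrow> x = 0"
  proof
    assume "inner x x = 0"
    then have "inner (ell2_nth x n) (ell2_nth x n) = 0" for n
      by (intro nonneg_infsum_le_0D[OF _ inner_summable[of x x]]) (auto simp: inner_ell2_conv)
    then show "x = 0" by (intro ell2_eqI) (simp add: zero_ell2.rep_eq)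
  qed (simp add: inner_ell2_conv zero_ell2.rep_eq)
qed

end

lemma ell2_norm_square: "(norm x)\<^sup>2 = (\<Sum>\<^sub>\<infinity>n\<in>UNIV. (norm (ell2_nth x n))\<^sup>2)"
  by (simp add: power2_norm_eq_inner inner_ell2_conv)

lemma ell2_sum_le_norm: "finite A \<Longrightarrow> (\<Sum>n\<in>A. (norm (ell2_nth x n))\<^sup>2) \<le> (norm x)\<^sup>2"
  unfolding ell2_norm_square by (rule finite_sum_le_infsum) (auto simp: ell2_summable)

lemma ell2_nth_norm_le: "norm (ell2_nth x n) \<le> norm x"
  using ell2_sum_le_norm[of "{n}" x] by (simp add: power2_le_iff_abs_le)

lemma ell2_norm_leI:
  assumes "\<And>A. finite A \<Longrightarrow> (\<Sum>n\<in>A. (norm (ell2_nth x n))\<^sup>2) \<le> C\<^sup>2" "C \<ge> 0"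
  shows "norm x \<le> C"
proof -
  have "(norm x)\<^sup>2 \<le> C\<^sup>2"
    unfolding ell2_norm_square by (rule infsum_le_finite_sums[OF ell2_summable assms(1)])
  then show ?thesis using assms(2) by (rule power2_le_imp_le)
qed

instance ell2 :: (complex_hilbert) complex_hilbert
proof
  fix X :: "nat \<Rightarrow> 'a ell2"
  assume X: "Cauchy X"
  have "Cauchy (\<lambda>k. ell2_nth (X k) n)" for n
  proof (rule CauchyI)
    fix e :: real assume "e > 0"
    then obtain M where M: "\<And>k l. k \<ge> M \<Longrightarrow> l \<ge> M \<Longrightarrow> norm (X k - X l) < e"
      using CauchyD[OF X] by blast
    have "norm (ell2_nth (X k) n - ell2_nth (X l) n) < e" if "k \<ge> M" "l \<ge> M" for k l
      using ell2_nth_norm_le[of "X k - X l" n] M[OF that] by (simp add: minus_ell2.rep_eq)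
    then show "\<exists>M. \<forall>k\<ge>M. \<forall>l\<ge>M. norm (ell2_nth (X k) n - ell2_nth (X l) n) < e" by blast
  qed
  then have "\<exists>l. (\<lambda>k. ell2_nth (X k) n) \<longlonglongrightarrow> l" for n
    by (simp add: Cauchy_convergent_iff convergent_def)
  then obtain l where l: "\<And>n. (\<lambda>k. ell2_nth (X k) n) \<longlonglongrightarrow> l n" by metis
  have bound: "\<exists>M. \<forall>k\<ge>M. \<forall>A. finite A \<longrightarrow> (\<Sum>n\<in>A. (norm (ell2_nth (X k) n - l n))\<^sup>2) \<le> e\<^sup>2"
    if "e > 0" for e
  proof -
    obtain M where M: "\<And>k j. k \<ge> M \<Longrightarrow> j \<ge> M \<Longrightarrow> norm (X k - X j) < e"
      using CauchyD[OF X \<open>e > 0\<close>] by blast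
    have "(\<Sum>n\<in>A. (norm (ell2_nth (X k) n - l n))\<^sup>2) \<le> e\<^sup>2" if "k \<ge> M" "finite A" for k A
    proof (rule tendsto_upperbound)
      show "(\<lambda>j. \<Sum>n\<in>A. (norm (ell2_nth (X k) n - ell2_nth (X j) n))\<^sup>2)
          \<longlonglongrightarrow> (\<Sum>n\<in>A. (norm (ell2_nth (X k) n - l n))\<^sup>2)"
        by (intro tendsto_intros l)
      have "(\<Sum>n\<in>A. (norm (ell2_nth (X k) n - ell2_nth (X j) n))\<^sup>2) \<le> e\<^sup>2" if "j \<ge> M" for j
      proof -
        have "(norm (X k - X j))\<^sup>2 \<le> e\<^sup>2"
          using M[OF \<open>k \<ge> M\<close> that] by (intro power_mono) auto
        then show ?thesis
          using ell2_sum_le_norm[OF \<open>finite A\<close>, of "X k - X j"] by (simp add: minus_ell2.rep_eq)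
      qed
      then show "\<forall>\<^sub>F j in sequentially.
          (\<Sum>n\<in>A. (norm (ell2_nth (X k) n - ell2_nth (X j) n))\<^sup>2) \<le> e\<^sup>2"
        by (rule eventually_sequentiallyI)
    qed simp
    then show ?thesis by blast
  qed
  obtain M1 where M1: "\<And>A. finite A \<Longrightarrow> (\<Sum>n\<in>A. (norm (ell2_nth (X M1) n - l n))\<^sup>2) \<le> 1\<^sup>2"
    using bound[of 1] by auto
  have "(\<lambda>n. (norm (l n - ell2_nth (X M1) n))\<^sup>2) summable_on UNIV"
    using M1 by (intro nonneg_bdd_above_summable_on bdd_aboveI[of _ 1]) (auto simp: norm_minus_commute)
  from ell2_add_closed[OF this ell2_summable[of "X M1"]]
  have "(\<lambda>n. (norm (l n))\<^sup>2) summable_on UNIV" by simp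
  then have L: "ell2_nth (Abs_ell2 l) = l" by (simp add: Abs_ell2_inverse)
  have "X \<longlonglongrightarrow> Abs_ell2 l"
  proof (rule LIMSEQ_I)
    fix e :: real assume "e > 0"
    then obtain M where M: "\<And>k A. k \<ge> M \<Longrightarrow> finite A \<Longrightarrow>
        (\<Sum>n\<in>A. (norm (ell2_nth (X k) n - l n))\<^sup>2) \<le> (e/2)\<^sup>2"
      using bound[of "e/2"] by auto
    have "norm (X k - Abs_ell2 l) < e" if "k \<ge> M" for k
    proof -
      have "norm (X k - Abs_ell2 l) \<le> e/2"
        using M[OF that] \<open>e > 0\<close> by (intro ell2_norm_leI) (auto simp: minus_ell2.rep_eq L)
      then show ?thesis using \<open>e > 0\<close> by simp
    qed
    then show "\<exists>M. \<forall>k\<ge>M. norm (X k - Abs_ell2 l) < e" by blast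
  qed
  then show "convergent X" by (auto simp: convergent_def)
qed

section \<open>Operators on the space of square-summable sequences\<close>

lift_definition ell2_single :: "int \<Rightarrow> 'a::complex_inner \<Rightarrow> 'a ell2" is
  "\<lambda>j h n. if n = j then h else 0"
  subgoal for j h
    by (rule finite_nonzero_values_imp_summable_on) (rule finite_subset[of _ "{j}"], auto)
  done

text \<open>The entry \<open>U\<^sub>i\<^sub>j\<close> is recovered from \<open>(U x)\<^sub>i = (\<Sum>j. U\<^sub>i\<^sub>j x\<^sub>j)\<close> by taking \<open>x\<close> supported at \<open>j\<close>.\<close>

definition matrix_entry :: "('a::complex_inner ell2 \<Rightarrow> 'a ell2) \<Rightarrow> int \<Rightarrow> int \<Rightarrow> 'a \<Rightarrow> 'a" where
  "matrix_entry U i j = (\<lambda>h. ell2_nth (U (ell2_single j h)) i)"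

definition shift_weights :: "(int \<Rightarrow> 'a::complex_inner \<Rightarrow> 'a) \<Rightarrow> bool" where
  "shift_weights W \<longleftrightarrow> bounded_op_family W \<and> (\<forall>n. W n \<noteq> (\<lambda>_. 0))"

text \<open>The two operators below are only meaningful when \<open>W\<close> is a \<^const>\<open>bounded_op_family\<close>.\<close>

definition bilateral_shift :: "(int \<Rightarrow> 'a::complex_inner \<Rightarrow> 'a) \<Rightarrow> 'a ell2 \<Rightarrow> 'a ell2" where
  "bilateral_shift W x = Abs_ell2 (\<lambda>n. W n (ell2_nth x (n - 1)))"

definition diagonal_op :: "(int \<Rightarrow> 'a::complex_inner \<Rightarrow> 'a) \<Rightarrow> 'a ell2 \<Rightarrow> 'a ell2" where
  "diagonal_op W x = Abs_ell2 (\<lambda>n. W n (ell2_nth x n))"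

abbreviation flat_shift :: "'a::complex_inner ell2 \<Rightarrow> 'a ell2" where
  "flat_shift \<equiv> bilateral_shift (\<lambda>_. id)"

text \<open>Only meaningful for bijective \<open>A\<close>.\<close>

definition op_powi :: "('a \<Rightarrow> 'a) \<Rightarrow> int \<Rightarrow> 'a \<Rightarrow> 'a" where
  "op_powi A k = (if k \<ge> 0 then A ^^ nat k else inv A ^^ nat (- k))"

definition diagonal_form :: "('a::complex_inner ell2 \<Rightarrow> 'a ell2) \<Rightarrow> bool" where
  "diagonal_form U \<longleftrightarrow> (\<exists>k W. bounded_op_family W \<and> U = op_powi flat_shift k \<circ> diagonal_op W)"

lemma bounded_op_family_bound:
  assumes "bounded_op_family W"
  obtains C where "C \<ge> 0" "\<And>n h. norm (W n h) \<le> C * norm h"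
proof -
  have W: "bounded_linear (W n)" for n
    using assms by (simp add: bounded_op_family_def bounded_clinear_def)
  obtain C where C: "\<And>n. onorm (W n) \<le> C"
    using assms by (auto simp: bounded_op_family_def bdd_above_def)
  show thesis
  proof (rule that)
    show "C \<ge> 0" using onorm_pos_le[OF W] C order_trans by blast
    show "norm (W n h) \<le> C * norm h" for n h
      using onorm[OF W, of n h] mult_right_mono[OF C[of n] norm_ge_zero[of h]] by linarith
  qed
qed

lemma bounded_op_family_ell2:
  assumes "bounded_op_family W" "(\<lambda>n. (norm (x n))\<^sup>2) summable_on UNIV"
  shows "(\<lambda>n. (norm (W n (x n)))\<^sup>2) summable_on UNIV"
proof -
  obtain C where C: "C \<ge> 0" "\<And>n h. norm (W n h) \<le> C * norm h"
    using bounded_op_family_bound[OF assms(1)] by blast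
  show ?thesis
  proof (rule summable_on_comparison_test)
    show "(\<lambda>n. C\<^sup>2 * (norm (x n))\<^sup>2) summable_on UNIV"
      using assms(2) by (rule summable_on_cmult_right)
    show "(norm (W n (x n)))\<^sup>2 \<le> C\<^sup>2 * (norm (x n))\<^sup>2" for n
      using power_mono[OF C(2)[of n "x n"], of 2] by (simp add: power_mult_distrib)
  qed simp
qed

lemma ell2_nth_diagonal_op:
  assumes "bounded_op_family W"
  shows "ell2_nth (diagonal_op W x) n = W n (ell2_nth x n)"
  using bounded_op_family_ell2[OF assms ell2_summable]
  by (simp add: diagonal_op_def Abs_ell2_inverse)

lemma ell2_summable_translate: "(\<lambda>n. (norm (ell2_nth x (n + k)))\<^sup>2) summable_on UNIV"
proof -
  have "bij_betw (\<lambda>n::int. n + k) UNIV UNIV"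
    by (rule bij_betwI[of _ _ _ "\<lambda>n. n - k"]) auto
  from summable_on_reindex_bij_betw[OF this, of "\<lambda>n. (norm (ell2_nth x n))\<^sup>2"]
  show ?thesis using ell2_summable by blast
qed

lemma ell2_nth_bilateral_shift:
  assumes "bounded_op_family W"
  shows "ell2_nth (bilateral_shift W x) n = W n (ell2_nth x (n - 1))"
  using bounded_op_family_ell2[OF assms ell2_summable_translate[of x "-1"]]
  by (simp add: bilateral_shift_def Abs_ell2_inverse)

lemma bounded_op_family_id: "bounded_op_family (\<lambda>_. id :: 'a::complex_inner \<Rightarrow> 'a)"
  by (auto simp: bounded_op_family_def bounded_clinear_def id_def bounded_linear_ident)

lemma bij_flat_shift: "bij (flat_shift :: 'a::complex_inner ell2 \<Rightarrow> 'a ell2)"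
proof (rule bijI)
  show "inj (flat_shift :: 'a ell2 \<Rightarrow> 'a ell2)"
  proof (rule injI, rule ell2_eqI)
    fix x y :: "'a ell2" and n
    assume "flat_shift x = flat_shift y"
    then have "ell2_nth (flat_shift x) (n + 1) = ell2_nth (flat_shift y) (n + 1)" by simp
    then show "ell2_nth x n = ell2_nth y n"
      by (simp add: ell2_nth_bilateral_shift[OF bounded_op_family_id])
  qed
  show "surj (flat_shift :: 'a ell2 \<Rightarrow> 'a ell2)"
  proof (rule surjI)
    fix x :: "'a ell2"
    have "ell2_nth (Abs_ell2 (\<lambda>n. ell2_nth x (n + 1))) = (\<lambda>n. ell2_nth x (n + 1))"
      using ell2_summable_translate[of x 1] by (simp add: Abs_ell2_inverse)
    then show "flat_shift (Abs_ell2 (\<lambda>n. ell2_nth x (n + 1))) = x"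
      by (intro ell2_eqI) (simp add: ell2_nth_bilateral_shift[OF bounded_op_family_id])
  qed
qed

end

theory Submission
  imports Defs
begin

text \<open>
  The condition \<open>U\<^sub>0\<^sub>m \<noteq> 0\<close> forces \<open>U = F\<^sup>-\<^sup>m D\<close>, where \<open>D\<close> has unitary weights \<open>W\<^sub>j\<close>, and then \<open>U S = T U\<close> says
  \<open>W\<^sub>j S\<^sub>j = T\<^bsub>j-m\<^esub> W\<^bsub>j-1\<^esub>\<close> for all \<open>j\<close>, equivalently \<open>W\<^bsub>j-1\<^esub> S\<^sub>j\<^sup>* = T\<^bsub>j-m\<^esub>\<^sup>* W\<^sub>j\<close>.  Iterating both
  relations from \<open>V = W\<^bsub>m-1\<^esub>\<close> gives (a) and (b).  Conversely, by density of ranges the equality of norms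
  in (a) yields unitaries \<open>Q\<^sub>n\<close> with \<open>Q\<^sub>n S\<^bsub>m+n-1\<^esub> \<dots> S\<^sub>m = T\<^bsub>n-1\<^esub> \<dots> T\<^sub>0 V\<close>, and density again lets one cancel
  the common factor to obtain the relation for \<open>j \<ge> m\<close> with \<open>W\<^bsub>m-1+n\<^esub> = Q\<^sub>n\<close>; (b) gives in the same way the
  adjoint relation for \<open>j < m\<close>.
\<close>

section \<open>Adjoints\<close>

text \<open>The representing vector is the minimiser of \<open>J\<close>: boundedness of
  \<open>f\<close> bounds \<open>J\<close> below, the parallelogram law makes a minimising sequence
  Cauchy, and stationarity of \<open>J\<close> at its limit \<open>z\<close> says
  \<open>f x = inner x z\<close>.\<close>

lemma riesz_representation:
  fixes f :: "'a::{real_inner,complete_space} \<Rightarrow> real"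
  assumes "bounded_linear f"
  shows "\<exists>z. \<forall>x. f x = inner x z"
proof -
  interpret bounded_linear f by fact
  obtain K where K: "\<And>x. norm (f x) \<le> norm x * K"
    using bounded by blast
  define J where "J = (\<lambda>x. (norm x)\<^sup>2 - 2 * f x)"
  have J_ge: "- K\<^sup>2 \<le> J x" for x
  proof -
    have "2 * f x \<le> 2 * norm x * K" using K[of x] by simp
    moreover have "0 \<le> (norm x - K)\<^sup>2" by simp
    ultimately show ?thesis by (simp add: J_def power2_diff)
  qed
  then have bdd: "bdd_below (range J)" by (intro bdd_belowI[of _ "- K\<^sup>2"]) auto
  define d where "d = Inf (range J)"
  have d_le: "d \<le> J x" for x
    unfolding d_def using bdd by (rule cInf_lower2[rotated 2]) auto
  define \<delta> where "\<delta> = (\<lambda>n. inverse (real (Suc n)))"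
  have \<delta>_lim: "\<delta> \<longlonglongrightarrow> 0" unfolding \<delta>_def by (rule LIMSEQ_inverse_real_of_nat)
  have "\<exists>x. J x < d + \<delta> n" for n
    using cInf_lessD[of "range J" "d + \<delta> n"] by (auto simp: d_def \<delta>_def)
  then obtain X where X: "\<And>n. J (X n) < d + \<delta> n" by metis
  \<comment> \<open>The linear part of \<open>J\<close> cancels in this combination, leaving the
    usual parallelogram law.\<close>
  have parallelogram: "(norm (x - y))\<^sup>2 = 2 * J x + 2 * J y - 4 * J ((1/2) *\<^sub>R (x + y))" for x y
    by (simp add: J_def add scaleR power2_norm_eq_inner algebra_simps inner_commute)
  have dist_X: "(norm (X k - X l))\<^sup>2 \<le> 2 * \<delta> k + 2 * \<delta> l" for k l
    using parallelogram[of "X k" "X l"] X[of k] X[of l] d_le[of "(1/2) *\<^sub>R (X k + X l)"] by linarith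
  have "Cauchy X"
  proof (rule CauchyI)
    fix e :: real assume "e > 0"
    then have "\<forall>\<^sub>F n in sequentially. \<delta> n < e\<^sup>2 / 4"
      using order_tendstoD(2)[OF \<delta>_lim, of "e\<^sup>2 / 4"] by simp
    then obtain M where M: "\<And>n. n \<ge> M \<Longrightarrow> \<delta> n < e\<^sup>2 / 4"
      by (auto simp: eventually_sequentially)
    have "norm (X k - X l) < e" if "k \<ge> M" "l \<ge> M" for k l
    proof -
      have "(norm (X k - X l))\<^sup>2 < e\<^sup>2"
        using dist_X[of k l] M[OF that(1)] M[OF that(2)] by linarith
      then show ?thesis by (rule power2_less_imp_less) (use \<open>e > 0\<close> in simp)
    qed
    then show "\<exists>M. \<forall>k\<ge>M. \<forall>l\<ge>M. norm (X k - X l) < e" by blast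
  qed
  then obtain z where z: "X \<longlonglongrightarrow> z"
    using Cauchy_convergent_iff convergent_def by blast
  have "(\<lambda>n. J (X n)) \<longlonglongrightarrow> J z"
    unfolding J_def by (intro tendsto_intros z tendsto)
  moreover have "(\<lambda>n. d + \<delta> n) \<longlonglongrightarrow> d + 0"
    by (intro tendsto_intros \<delta>_lim)
  ultimately have "J z \<le> d"
    using LIMSEQ_le[of "\<lambda>n. J (X n)" "J z" "\<lambda>n. d + \<delta> n" "d + 0"] X
    by (auto intro: less_imp_le)
  then have min: "J z \<le> J y" for y using d_le[of y] by linarith
  have "f x = inner x z" for x
  proof (cases "x = 0")
    case False
    define c where "c = inner x z - f x"
    \<comment> \<open>This \<open>t\<close> minimises the quadratic
      \<open>t^2 * (norm x)^2 + 2 * t * c\<close>, the increment of \<open>J\<close> along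
      \<open>x\<close>.\<close>
    define t where "t = - (c / (norm x)\<^sup>2)"
    have "J (z + t *\<^sub>R x) = J z + t\<^sup>2 * (norm x)\<^sup>2 + 2 * t * c"
      by (simp add: J_def c_def add scaleR power2_norm_eq_inner power2_eq_square[of t] algebra_simps inner_commute)
    also have "\<dots> = J z - c\<^sup>2 / (norm x)\<^sup>2"
      using False by (simp add: t_def power2_eq_square field_simps)
    finally have "c\<^sup>2 / (norm x)\<^sup>2 \<le> 0" using min[of "z + t *\<^sub>R x"] by simp
    then have "c = 0"
      using False by (simp add: divide_le_0_iff)
    then show ?thesis by (simp add: c_def)
  qed (simp add: zero)
  then show ?thesis by blast
qed

text \<open>Since Im w = Re (-i w), complex identities for complex linear maps reduce to the real
  inner product.\<close>

lemma Im_cinner: "Im (cinner x y) = inner ((- \<i>) *\<^sub>C x) y"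
  using Re_cinner[of "(- \<i>) *\<^sub>C x" y] by (simp add: cinner_scaleC_left)

lemmas inner_eqI = vector_eq_ldot[THEN iffD1, rule_format]

text \<open>\<open>cadjoint\<close> is a definite description, so existence and uniqueness are both
  due. Riesz for the real inner product gives \<open>B\<close>; complex linearity of
  \<open>A\<close> makes \<open>B\<close> fit the imaginary parts too; real parts alone force
  uniqueness.\<close>

lemma cinner_adjoint:
  fixes A :: "'a::complex_hilbert \<Rightarrow> 'b::complex_hilbert"
  assumes A: "bounded_clinear A"
  shows "cinner (A x) y = cinner x (cadjoint A y)"
proof -
  have lin: "bounded_linear A" and cx: "\<And>c x. A (c *\<^sub>C x) = c *\<^sub>C A x"
    using A by (auto simp: bounded_clinear_def)
  have "\<exists>z. \<forall>x. inner (A x) y = inner x z" for y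
    by (rule riesz_representation) (rule bounded_linear_compose[OF bounded_linear_inner_left lin])
  then obtain B where B: "\<And>x y. inner (A x) y = inner x (B y)" by metis
  have cB: "cinner (A x) y = cinner x (B y)" for x y
    by (rule complex_eqI) (simp_all add: Re_cinner Im_cinner B flip: cx)
  have "C = B" if C: "\<forall>x y. cinner (A x) y = cinner x (C y)" for C
  proof
    fix y
    show "C y = B y"
      by (rule inner_eqI) (metis C cB Re_cinner)
  qed
  then have "cadjoint A = B"
    unfolding cadjoint_def using cB by (intro the_equality) auto
  then show ?thesis by (simp add: cB)
qed

lemma inner_adjoint: "bounded_clinear A \<Longrightarrow> inner (A x) y = inner x (cadjoint A y)"
  by (metis Re_cinner cinner_adjoint)

lemma cadjoint_eqI:
  assumes "bounded_clinear A" "\<And>x y. inner (A x) y = inner x (B y)"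
  shows "cadjoint A = B"
  by (rule ext, rule inner_eqI) (metis assms inner_adjoint)

lemma cinner_scaleC_right: "cinner x (c *\<^sub>C y) = cnj c * cinner x y"
  by (metis cinner_commute cinner_scaleC_left complex_cnj_mult)

lemma inner_scaleC_right: "inner x (c *\<^sub>C y) = inner (cnj c *\<^sub>C x) y"
  by (metis Re_cinner cinner_scaleC_left cinner_scaleC_right)

lemma bounded_clinear_cadjoint:
  assumes A: "bounded_clinear A"
  shows "bounded_clinear (cadjoint A)"
proof -
  have lin: "bounded_linear A" and cx: "\<And>c x. A (c *\<^sub>C x) = c *\<^sub>C A x"
    using A by (auto simp: bounded_clinear_def)
  obtain K where K: "K \<ge> 0" "\<And>x. norm (A x) \<le> norm x * K"
    using bounded_linear.nonneg_bounded[OF lin] by blast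
  \<comment> \<open>Cauchy-Schwarz bounds the square of the left side by \<open>K\<close> times
    itself times \<open>norm y\<close>; one factor is then divided out.\<close>
  have bound: "norm (cadjoint A y) \<le> norm y * K" for y
  proof (cases "cadjoint A y = 0")
    case False
    have "(norm (cadjoint A y))\<^sup>2 = inner (A (cadjoint A y)) y"
      by (simp add: inner_adjoint[OF A] power2_norm_eq_inner)
    also have "\<dots> \<le> norm (cadjoint A y) * K * norm y"
      by (rule order_trans[OF norm_cauchy_schwarz mult_right_mono[OF K(2)]]) simp
    finally show ?thesis using False by (simp add: power2_eq_square mult_ac)
  qed (simp add: K)
  have "bounded_linear (cadjoint A)"
  proof (rule bounded_linear_intro[OF _ _ bound])
    show "cadjoint A (x + y) = cadjoint A x + cadjoint A y" for x y
      by (rule inner_eqI) (simp add: inner_add_right flip: inner_adjoint[OF A])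
    show "cadjoint A (r *\<^sub>R x) = r *\<^sub>R cadjoint A x" for r x
      by (rule inner_eqI) (simp flip: inner_adjoint[OF A])
  qed
  moreover have "cadjoint A (c *\<^sub>C x) = c *\<^sub>C cadjoint A x" for c x
    by (rule inner_eqI) (simp add: inner_scaleC_right cx flip: inner_adjoint[OF A])
  ultimately show ?thesis by (simp add: bounded_clinear_def)
qed

lemma cadjoint_cadjoint: "bounded_clinear A \<Longrightarrow> cadjoint (cadjoint A) = A"
  by (rule cadjoint_eqI) (metis bounded_clinear_cadjoint, metis inner_adjoint inner_commute)

lemma bounded_clinear_comp: "bounded_clinear A \<Longrightarrow> bounded_clinear B \<Longrightarrow> bounded_clinear (A \<circ> B)"
  by (simp add: bounded_clinear_def o_def bounded_linear_compose)

lemma bounded_clinear_id: "bounded_clinear id"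
  by (simp add: bounded_clinear_def id_def bounded_linear_ident)

lemma cadjoint_comp:
  "bounded_clinear A \<Longrightarrow> bounded_clinear B \<Longrightarrow> cadjoint (A \<circ> B) = cadjoint B \<circ> cadjoint A"
  by (rule cadjoint_eqI) (simp_all add: bounded_clinear_comp inner_adjoint)

section \<open>Unitary operators\<close>

text \<open>By polarization an isometry preserves inner products, so \<open>cadjoint U\<close> is a
  left inverse; surjectivity makes it a right inverse.\<close>

lemma unitary_op_iff:
  "unitary_op U \<longleftrightarrow> bounded_clinear U \<and> (\<forall>x. norm (U x) = norm x) \<and> surj U"
proof
  assume U: "unitary_op U"
  then have b: "bounded_clinear U" by (simp add: unitary_op_def)
  moreover have "inner (U x) (U x) = inner x x" for x
    using U by (simp add: inner_adjoint[OF b] unitary_op_def fun_eq_iff)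
  then have "norm (U x) = norm x" for x by (simp add: norm_eq_sqrt_inner)
  moreover have "surj U"
    using U by (intro surjI[of _ "cadjoint U"]) (simp add: unitary_op_def fun_eq_iff)
  ultimately show "bounded_clinear U \<and> (\<forall>x. norm (U x) = norm x) \<and> surj U" by blast
next
  assume "bounded_clinear U \<and> (\<forall>x. norm (U x) = norm x) \<and> surj U"
  then have U: "bounded_clinear U" "\<forall>x. norm (U x) = norm x" "surj U" by blast+
  interpret bounded_linear U using U by (simp add: bounded_clinear_def)
  have isometry: "inner (U x) (U y) = inner x y" for x y
    using U(2) by (simp add: dot_norm flip: add)
  have UU: "cadjoint U (U y) = y" for y
    by (rule inner_eqI) (simp add: isometry flip: inner_adjoint[OF U(1)])
  then have "U (cadjoint U y) = y" for y
    using U(3) by (metis surj_def)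
  with UU show "unitary_op U" by (simp add: unitary_op_def U fun_eq_iff)
qed

text \<open>Take adjoints of the relation, then multiply by \<open>Y\<close> on the left and by
  \<open>X\<close> on the right. Applied twice, this passes between a relation for weights and one
  for their adjoints.\<close>

lemma unitary_op_intertwine_adjoint:
  assumes X: "unitary_op X" and Y: "unitary_op Y" and "bounded_clinear A" "bounded_clinear B"
    and "X \<circ> A = B \<circ> Y"
  shows "Y \<circ> cadjoint A = cadjoint B \<circ> X"
proof -
  have "cadjoint A \<circ> cadjoint X = cadjoint Y \<circ> cadjoint B"
    using assms by (simp add: unitary_op_def flip: cadjoint_comp)
  then have "Y (cadjoint A (cadjoint X (X x))) = Y (cadjoint Y (cadjoint B (X x)))" for x
    by (simp add: fun_eq_iff)
  then show ?thesis
    using X Y by (simp add: unitary_op_def fun_eq_iff)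
qed

section \<open>Dense ranges and extension to unitaries\<close>

lemma dense_rangeD:
  assumes "dense_range A"
  obtains x where "(\<lambda>n. A (x n)) \<longlonglongrightarrow> y"
proof -
  have "y \<in> closure (range A)" using assms by (simp add: dense_range_def)
  then obtain a where a: "\<And>n. a n \<in> range A" "a \<longlonglongrightarrow> y"
    by (auto simp: closure_sequential)
  have "\<forall>n. \<exists>x. a n = A x" using a(1) by blast
  then obtain x where "\<forall>n. a n = A (x n)" by (rule choice[THEN exE])
  then have "a = (\<lambda>n. A (x n))" by (simp add: fun_eq_iff)
  with a(2) show thesis by (intro that) simp
qed

lemma dense_range_comp:
  assumes "dense_range A" "dense_range B" "bounded_clinear B"
  shows "dense_range (B \<circ> A)"
proof -
  have "continuous_on UNIV B"
    using assms(3) by (simp add: bounded_clinear_def linear_continuous_on)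
  then have "B ` closure (range A) \<subseteq> closure (B ` range A)"
    using assms(1) by (intro image_closure_subset) (auto simp: dense_range_def closure_subset[THEN subsetD])
  then have "range B \<subseteq> closure (range (B \<circ> A))"
    using assms(1) by (simp add: dense_range_def image_comp)
  then have "closure (range B) \<subseteq> closure (range (B \<circ> A))"
    by (simp add: closure_minimal)
  then show ?thesis using assms(2) by (auto simp: dense_range_def)
qed

lemma dense_range_surj: "surj A \<Longrightarrow> dense_range A"
  by (simp add: dense_range_def)

lemma dense_range_cancel:
  assumes "dense_range A" "bounded_clinear X" "bounded_clinear Y" "X \<circ> A = Y \<circ> A"
  shows "X = Y"
proof
  fix y
  obtain x where x: "(\<lambda>n. A (x n)) \<longlonglongrightarrow> y"
    using assms(1) by (rule dense_rangeD)
  have X: "(\<lambda>n. X (A (x n))) \<longlonglongrightarrow> X y" and Y: "(\<lambda>n. Y (A (x n))) \<longlonglongrightarrow> Y y"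
    using assms by (auto simp: bounded_clinear_def intro: bounded_linear.tendsto[OF _ x])
  have "X (A (x n)) = Y (A (x n))" for n
    using assms(4) by (simp add: fun_eq_iff)
  with X show "X y = Y y" by (simp add: LIMSEQ_unique[OF _ Y])
qed

text \<open>Differences of images have equal norms under \<open>A\<close> and \<open>B\<close>, so
  Cauchyness carries over and completeness supplies the limit.\<close>

lemma equinorm_Cauchy:
  assumes "bounded_linear A" "bounded_linear B" "\<And>x. norm (A x) = norm (B x)"
    and "(\<lambda>n. A (x n)) \<longlonglongrightarrow> y"
  obtains z where "(\<lambda>n. B (x n)) \<longlonglongrightarrow> (z::'b::{real_normed_vector,complete_space})"
proof -
  have "norm (A (x k) - A (x l)) = norm (B (x k) - B (x l))" for k l
    using assms(3)[of "x k - x l"] by (simp add: assms linear_simps)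
  then have "Cauchy (\<lambda>n. B (x n))"
    using LIMSEQ_imp_Cauchy[OF assms(4)] by (simp add: Cauchy_def dist_norm)
  then show thesis using that Cauchy_convergent_iff convergent_def by blast
qed

text \<open>The assignment of \<open>B x\<close> to \<open>A x\<close> is isometric, and its closure
  is the graph of \<open>V\<close>. Working with the relation \<open>R\<close> postpones
  well-definedness and treats \<open>A\<close> and \<open>B\<close> symmetrically, so surjectivity
  is totality of the converse relation.\<close>

lemma unitary_extension:
  fixes A B :: "'a::complex_hilbert \<Rightarrow> 'a"
  assumes A: "bounded_clinear A" and B: "bounded_clinear B"
    and dA: "dense_range A" and dB: "dense_range B"
    and eq: "\<And>x. norm (A x) = norm (B x)"
  obtains V where "unitary_op V" "V \<circ> A = B"
proof -
  have lA: "bounded_linear A" and lB: "bounded_linear B"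
    and cA: "\<And>c x. A (c *\<^sub>C x) = c *\<^sub>C A x" and cB: "\<And>c x. B (c *\<^sub>C x) = c *\<^sub>C B x"
    using A B by (auto simp: bounded_clinear_def)
  interpret A: bounded_linear A by fact
  interpret B: bounded_linear B by fact
  \<comment> \<open>One sequence \<open>x\<close> serves both limits; \<open>x\<close> itself need
    not converge.\<close>
  define R where "R y z \<longleftrightarrow> (\<exists>x. (\<lambda>n. A (x n)) \<longlonglongrightarrow> y \<and> (\<lambda>n. B (x n)) \<longlonglongrightarrow> z)" for y z
  have R_left: "\<exists>z. R y z" for y
    unfolding R_def by (metis dense_rangeD[OF dA] equinorm_Cauchy[OF lA lB eq])
  have R_right: "\<exists>y. R y z" for z
    unfolding R_def by (metis dense_rangeD[OF dB] equinorm_Cauchy[OF lB lA eq[symmetric]])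
  have R_norm: "norm y = norm z" if yz: "R y z" for y z
  proof -
    obtain x where "(\<lambda>n. A (x n)) \<longlonglongrightarrow> y" "(\<lambda>n. B (x n)) \<longlonglongrightarrow> z"
      using yz by (auto simp: R_def)
    then have "(\<lambda>n. norm (A (x n))) \<longlonglongrightarrow> norm y" "(\<lambda>n. norm (B (x n))) \<longlonglongrightarrow> norm z"
      by (auto intro: tendsto_norm)
    then show ?thesis by (simp add: eq LIMSEQ_unique)
  qed
  have R_add: "R (y + y') (z + z')" if "R y z" "R y' z'" for y y' z z'
  proof -
    obtain x x' where "(\<lambda>n. A (x n)) \<longlonglongrightarrow> y" "(\<lambda>n. B (x n)) \<longlonglongrightarrow> z"
      "(\<lambda>n. A (x' n)) \<longlonglongrightarrow> y'" "(\<lambda>n. B (x' n)) \<longlonglongrightarrow> z'"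
      using \<open>R y z\<close> \<open>R y' z'\<close> by (auto simp: R_def)
    then show ?thesis
      unfolding R_def by (intro exI[of _ "\<lambda>n. x n + x' n"]) (simp add: A.add B.add tendsto_add)
  qed
  have scaleC: "bounded_linear (\<lambda>x::'a. c *\<^sub>C x)" for c
    by (rule bounded_linear_intro[of _ "cmod c"])
      (simp_all add: scaleC_add_right norm_scaleC scaleC_scaleC mult.commute flip: scaleC_of_real)
  have R_scaleC: "R (c *\<^sub>C y) (c *\<^sub>C z)" if yz: "R y z" for c y z
  proof -
    obtain x where "(\<lambda>n. A (x n)) \<longlonglongrightarrow> y" "(\<lambda>n. B (x n)) \<longlonglongrightarrow> z"
      using yz by (auto simp: R_def)
    then show ?thesis
      unfolding R_def
      by (intro exI[of _ "\<lambda>n. c *\<^sub>C x n"]) (simp add: cA cB bounded_linear.tendsto[OF scaleC])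
  qed
  have R_scaleR: "R (r *\<^sub>R y) (r *\<^sub>R z)" if "R y z" for r y z
    using R_scaleC[OF that, of "complex_of_real r"] by (simp add: scaleC_of_real)
  \<comment> \<open>Subtracting the two pairs relates 0 to \<open>z - z'\<close>, which therefore
    has norm 0.\<close>
  have R_unique: "z = z'" if "R y z" "R y z'" for y z z'
    using R_norm[OF R_add[OF that(1) R_scaleR[OF that(2), of "-1"]]] by simp
  obtain V where V: "\<And>y. R y (V y)" using R_left by metis
  have VI: "V y = z" if "R y z" for y z
    using V that by (rule R_unique)
  have "bounded_linear V"
    by (rule bounded_linear_intro[of _ 1])
      (simp_all add: VI[OF R_add[OF V V]] VI[OF R_scaleR[OF V]] flip: R_norm[OF V])
  then have "bounded_clinear V"
    by (simp add: bounded_clinear_def VI[OF R_scaleC[OF V]])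
  moreover have "surj V" using R_right VI by (metis surjI)
  ultimately have "unitary_op V"
    by (simp add: unitary_op_iff flip: R_norm[OF V])
  moreover have "V (A x) = B x" for x
    by (rule VI) (auto simp: R_def intro!: exI[of _ "\<lambda>_. x"])
  ultimately show thesis using that by (metis comp_def ext)
qed

section \<open>Chains of intertwined operators\<close>

lemma bounded_clinear_fold:
  "(\<And>n. bounded_clinear (A n)) \<Longrightarrow> bounded_clinear (fold A xs)"
  by (induction xs) (simp_all add: bounded_clinear_id bounded_clinear_comp)

lemma dense_range_fold:
  assumes "\<And>n. bounded_clinear (A n)" "\<And>n. dense_range (A n)"
  shows "dense_range (fold A xs)"
proof (induction xs)
  case Nil
  show ?case by (simp add: dense_range_surj)
next
  case (Cons n xs)
  then have "dense_range (fold A xs \<circ> A n)"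
    by (intro dense_range_comp assms bounded_clinear_fold)
  then show ?case by (simp add: comp_def)
qed

text \<open>\<open>fold\<close> applies \<open>A 0\<close> first, so \<open>Q\<close> moves past one
  factor at a time and ends as \<open>Q 0\<close> next to the argument.\<close>

lemma intertwining_fold:
  assumes "\<And>n. Q (Suc n) \<circ> A n = B n \<circ> Q n"
  shows "Q n (fold A [0..<n] x) = fold B [0..<n] (Q 0 x)"
  using assms by (induction n) (simp_all add: fun_eq_iff)

text \<open>Each \<open>Q n\<close> comes independently from \<open>unitary_extension\<close>
  applied to the products of length \<open>n\<close>. The one-step relation then holds on the range
  of the product of the \<open>A\<close> factors, which is dense.\<close>

lemma intertwining_unitaries:
  fixes A B :: "nat \<Rightarrow> 'a::complex_hilbert \<Rightarrow> 'a"
  assumes A: "\<And>n. bounded_clinear (A n)" "\<And>n. dense_range (A n)"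
    and B: "\<And>n. bounded_clinear (B n)" "\<And>n. dense_range (B n)"
    and V: "unitary_op V"
    and eq: "\<And>n x. norm (fold A [0..<n] x) = norm (fold B [0..<n] (V x))"
  obtains Q where "Q 0 = V" "\<And>n. unitary_op (Q n)" "\<And>n. Q (Suc n) \<circ> A n = B n \<circ> Q n"
proof -
  let ?A = "\<lambda>n. fold A [0..<n]" and ?B = "\<lambda>n. fold B [0..<n] \<circ> V"
  have "\<exists>W. unitary_op W \<and> W \<circ> ?A n = ?B n" for n
  proof -
    have "bounded_clinear V" "dense_range V"
      using V by (auto simp: unitary_op_iff dense_range_surj)
    then have "bounded_clinear (?B n)" "dense_range (?B n)"
      using B by (simp_all add: bounded_clinear_comp bounded_clinear_fold dense_range_comp dense_range_fold)
    then show ?thesis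
      using unitary_extension[of "?A n" "?B n"] A eq
      by (metis bounded_clinear_fold comp_apply dense_range_fold)
  qed
  then obtain Q where Q: "\<And>n. unitary_op (Q n)" "\<And>n. Q n \<circ> ?A n = ?B n" by metis
  have bQ: "bounded_clinear (Q n)" for n using Q(1) by (simp add: unitary_op_def)
  show thesis
  proof (rule that)
    show "Q 0 = V" using Q(2)[of 0] by simp
    show "Q (Suc n) \<circ> A n = B n \<circ> Q n" for n
    proof (rule dense_range_cancel)
      show "dense_range (?A n)" using A by (rule dense_range_fold)
      \<comment> \<open>Both sides equal the product of the first \<open>n + 1\<close> factors
        \<open>B\<close> composed with \<open>V\<close>.\<close>
      show "Q (Suc n) \<circ> A n \<circ> ?A n = B n \<circ> Q n \<circ> ?A n"
        using Q(2)[of "Suc n"] Q(2)[of n] by (simp add: o_assoc[symmetric])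
    qed (simp_all add: A B bQ bounded_clinear_comp)
  qed (rule Q)
qed

lemma fold_upto_conv_upt: "fold f [a..a + int n - 1] = fold (\<lambda>j. f (a + int j)) [0..<n]"
proof (induction n)
  case (Suc n)
  have "[a..a + int (Suc n) - 1] = [a..a + int n - 1] @ [a + int n]"
    by (subst upto_rec2) simp_all
  with Suc show ?case by simp
qed simp

text \<open>\<open>foldr\<close> applies the last entry \<open>a - 1\<close> first and moves down,
  hence the index \<open>a - int j - 1\<close>.\<close>

lemma foldr_upto_conv_upt: "foldr f [a - int n..a - 1] = fold (\<lambda>j. f (a - int j - 1)) [0..<n]"
proof (induction n)
  case (Suc n)
  have "[a - int (Suc n)..a - 1] = (a - int n - 1) # [a - int n..a - 1]"
    by (subst upto_rec1) (simp_all add: algebra_simps)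
  with Suc show ?case by simp
qed simp

section \<open>Operators of diagonal form\<close>

text \<open>Negative powers are iterates of \<open>inv flat_shift\<close>, whose entries are found
  by shifting forward once and using surjectivity.\<close>

lemma ell2_nth_op_powi_flat_shift:
  "ell2_nth (op_powi flat_shift k x) n = ell2_nth x (n - k)"
proof -
  have pow: "ell2_nth ((flat_shift ^^ j) x) n = ell2_nth x (n - int j)" for j n and x :: "'a ell2"
    by (induction j arbitrary: n)
      (simp_all add: ell2_nth_bilateral_shift[OF bounded_op_family_id] algebra_simps)
  have inv1: "ell2_nth (inv flat_shift x) n = ell2_nth x (n + 1)" for n and x :: "'a ell2"
  proof -
    have "ell2_nth (flat_shift (inv flat_shift x)) (n + 1) = ell2_nth x (n + 1)"
      by (simp add: surj_f_inv_f[OF bij_is_surj[OF bij_flat_shift]])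
    then show ?thesis by (simp add: ell2_nth_bilateral_shift[OF bounded_op_family_id])
  qed
  have "ell2_nth ((inv flat_shift ^^ j) x) n = ell2_nth x (n + int j)" for j n and x :: "'a ell2"
    by (induction j arbitrary: n) (simp_all add: inv1 algebra_simps)
  then show ?thesis by (simp add: op_powi_def pow)
qed

lemma ell2_nth_shifted_diagonal:
  assumes "bounded_op_family W"
  shows "ell2_nth ((op_powi flat_shift k \<circ> diagonal_op W) x) n = W (n - k) (ell2_nth x (n - k))"
  by (simp add: ell2_nth_op_powi_flat_shift ell2_nth_diagonal_op[OF assms])

lemma bij_betw_translate_int: "bij_betw (\<lambda>n::int. n - k) UNIV UNIV"
  by (rule bij_betwI[of _ _ _ "\<lambda>n. n + k"]) auto

lemma bounded_op_family_unitary: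
  assumes "\<And>n. unitary_op (W n)"
  shows "bounded_op_family W"
proof -
  have "onorm (W n) \<le> 1" for n
    using assms[of n] by (intro onorm_bound) (simp_all add: unitary_op_iff)
  then show ?thesis
    using assms by (auto simp: bounded_op_family_def unitary_op_def intro!: bdd_aboveI[of _ 1])
qed

lemma norm_ell2_single: "norm (ell2_single j h) = norm h"
proof -
  have "(norm (ell2_single j h))\<^sup>2 = (\<Sum>\<^sub>\<infinity>n\<in>{j}. (norm h)\<^sup>2)"
    unfolding ell2_norm_square by (rule infsum_cong_neutral) (auto simp: ell2_single.rep_eq)
  then show ?thesis by simp
qed

text \<open>The shift only reindexes the sum of squared norms. A preimage is built entrywise; it is
  square-summable because the \<open>W n\<close> are isometric.\<close>

lemma unitary_shifted_diagonal:
  fixes W :: "int \<Rightarrow> 'a::complex_hilbert \<Rightarrow> 'a"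
  assumes W: "\<And>n. unitary_op (W n)"
  shows "unitary_op (op_powi flat_shift k \<circ> diagonal_op W)"
proof -
  let ?U = "op_powi flat_shift k \<circ> diagonal_op W"
  note nth = ell2_nth_shifted_diagonal[OF bounded_op_family_unitary[OF W], of k]
  have lin: "bounded_linear (W n)" and cx: "\<And>c x. W n (c *\<^sub>C x) = c *\<^sub>C W n x"
    and iso: "\<And>x. norm (W n x) = norm x" and surj: "surj (W n)" for n
    using W by (auto simp: unitary_op_iff bounded_clinear_def)
  have norm_U: "norm (?U x) = norm x" for x
  proof -
    have "(norm (?U x))\<^sup>2 = (norm x)\<^sup>2"
      unfolding ell2_norm_square nth iso
      by (rule infsum_reindex_bij_betw[OF bij_betw_translate_int])
    then show ?thesis by simp
  qed
  have "bounded_linear ?U"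
  proof (rule bounded_linear_intro[of _ 1])
    show "?U (x + y) = ?U x + ?U y" for x y
      by (rule ell2_eqI) (simp only: nth plus_ell2.rep_eq linear_simps[OF lin])
    show "?U (r *\<^sub>R x) = r *\<^sub>R ?U x" for r x
      by (rule ell2_eqI) (simp only: nth scaleR_ell2.rep_eq linear_simps[OF lin])
  qed (simp only: norm_U mult_1_right order_refl)
  moreover have "?U (c *\<^sub>C x) = c *\<^sub>C ?U x" for c x
    by (rule ell2_eqI) (simp only: nth scaleC_ell2.rep_eq cx)
  moreover have "surj ?U"
  proof (rule surjI)
    fix y :: "'a ell2"
    let ?x = "\<lambda>n. inv (W n) (ell2_nth y (n + k))"
    have W_inv: "W n (inv (W n) h) = h" for n h
      by (simp add: surj_f_inv_f surj)
    have "norm (?x n) = norm (ell2_nth y (n + k))" for n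
      by (metis W_inv iso)
    then have "(\<lambda>n. (norm (?x n))\<^sup>2) summable_on UNIV"
      by (simp add: ell2_summable_translate)
    then have "ell2_nth (Abs_ell2 ?x) = ?x" by (simp add: Abs_ell2_inverse)
    then show "?U (Abs_ell2 ?x) = y"
      by (intro ell2_eqI) (simp only: nth W_inv diff_add_cancel)
  qed
  ultimately show ?thesis
    unfolding unitary_op_iff bounded_clinear_def using norm_U by blast
qed

text \<open>Vectors supported at \<open>j\<close> go to vectors supported at \<open>j + k\<close>,
  so \<open>W j\<close> inherits the isometry. For surjectivity, entry \<open>j\<close> of a
  preimage of \<open>ell2_single (j + k) g\<close> is sent to \<open>g\<close>.\<close>

lemma unitary_weights:
  fixes W :: "int \<Rightarrow> 'a::complex_hilbert \<Rightarrow> 'a"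
  assumes W: "bounded_op_family W" and U: "unitary_op (op_powi flat_shift k \<circ> diagonal_op W)"
  shows "unitary_op (W j)"
proof -
  let ?U = "op_powi flat_shift k \<circ> diagonal_op W"
  note nth = ell2_nth_shifted_diagonal[OF W, of k]
  have Wj: "bounded_clinear (W n)" for n using W by (simp add: bounded_op_family_def)
  have W0: "W n 0 = 0" for n
    using Wj[of n] by (simp add: bounded_clinear_def linear_simps)
  have "norm (W j h) = norm h" for h
  proof -
    have "?U (ell2_single j h) = ell2_single (j + k) (W j h)"
      by (rule ell2_eqI, unfold nth) (auto simp: ell2_single.rep_eq W0)
    then show ?thesis
      using U by (metis norm_ell2_single unitary_op_iff)
  qed
  moreover have "surj (W j)"
  proof -
    have "\<exists>h. g = W j h" for g
    proof -
      obtain x where x: "?U x = ell2_single (j + k) g"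
        using U by (metis surj_def unitary_op_iff)
      have "W j (ell2_nth x j) = g"
        using nth[of x "j + k"] x by (simp add: ell2_single.rep_eq)
      then show ?thesis by blast
    qed
    then show ?thesis by (simp add: surj_def)
  qed
  ultimately show ?thesis using Wj by (simp add: unitary_op_iff)
qed

text \<open>Entry \<open>n\<close> of either composite depends only on entry
  \<open>n - k - 1\<close> of the argument; vectors supported at \<open>j - 1\<close> isolate the
  relation at \<open>j\<close>.\<close>

lemma shifted_diagonal_intertwines_iff:
  fixes S T W :: "int \<Rightarrow> 'a::complex_inner \<Rightarrow> 'a" and k :: int
  assumes W: "bounded_op_family W" and S: "bounded_op_family S" and T: "bounded_op_family T"
  defines "U \<equiv> op_powi flat_shift k \<circ> diagonal_op W"
  shows "U \<circ> bilateral_shift S = bilateral_shift T \<circ> U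
    \<longleftrightarrow> (\<forall>j. W j \<circ> S j = T (j + k) \<circ> W (j - 1))"
proof -
  have US: "ell2_nth ((U \<circ> bilateral_shift S) x) n = W (n - k) (S (n - k) (ell2_nth x (n - k - 1)))" for x n
    using ell2_nth_shifted_diagonal[OF W, of k "bilateral_shift S x" n]
    by (simp add: U_def ell2_nth_bilateral_shift[OF S])
  have TU: "ell2_nth ((bilateral_shift T \<circ> U) x) n = T n (W (n - k - 1) (ell2_nth x (n - k - 1)))" for x n
    using ell2_nth_shifted_diagonal[OF W, of k x "n - 1"]
    by (simp add: U_def ell2_nth_bilateral_shift[OF T] algebra_simps)
  show ?thesis
  proof (intro iffI allI)
    fix j assume eq: "U \<circ> bilateral_shift S = bilateral_shift T \<circ> U"
    show "W j \<circ> S j = T (j + k) \<circ> W (j - 1)"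
    proof
      fix h
      show "(W j \<circ> S j) h = (T (j + k) \<circ> W (j - 1)) h"
        using US[of "ell2_single (j - 1) h" "j + k"] TU[of "ell2_single (j - 1) h" "j + k"]
        by (simp add: eq ell2_single.rep_eq)
    qed
  next
    assume eq: "\<forall>j. W j \<circ> S j = T (j + k) \<circ> W (j - 1)"
    have "W (n - k) (S (n - k) h) = T n (W (n - k - 1) h)" for n h
      using fun_cong[OF eq[rule_format, of "n - k"], of h] by simp
    then show "U \<circ> bilateral_shift S = bilateral_shift T \<circ> U"
      by (intro ext ell2_eqI) (simp only: US TU)
  qed
qed

lemma matrix_entry_shifted_diagonal:
  assumes "bounded_op_family W"
  shows "matrix_entry (op_powi flat_shift k \<circ> diagonal_op W) i j
    = (\<lambda>h. if i = j + k then W j h else 0)"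
proof -
  have "W n 0 = 0" for n
    using assms by (simp add: bounded_op_family_def bounded_clinear_def linear_simps)
  then show ?thesis
    unfolding matrix_entry_def ell2_nth_shifted_diagonal[OF assms]
    by (auto simp: ell2_single.rep_eq fun_eq_iff)
qed

text \<open>\<open>fold\<close> starts with the head of its list and \<open>foldr\<close> with the
  last entry, so the weights applied first are those at \<open>m\<close> and 0 in (a), and the
  adjoints at \<open>m - 1\<close> and -1 in (b).\<close>

theorem theorem2p3:
  fixes S T :: "int \<Rightarrow> 'h::complex_hilbert \<Rightarrow> 'h" and m :: int
  assumes "\<exists>h::'h. h \<noteq> 0"
    and "shift_weights S" and "shift_weights T"
    and "\<And>n::nat. dense_range (S (m + int n))"
    and "\<And>n::nat. dense_range (T (int n))"
    and "\<And>n::nat. dense_range (cadjoint (S (m - int n - 1)))"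
    and "\<And>n::nat. dense_range (cadjoint (T (- int n - 1)))"
  shows "(\<exists>U. unitary_op U \<and> diagonal_form U \<and>
            U \<circ> bilateral_shift S = bilateral_shift T \<circ> U \<and>
            matrix_entry U 0 m \<noteq> (\<lambda>_. 0))
     \<longleftrightarrow> (\<exists>V. unitary_op V \<and>
            (\<forall>x. \<forall>n::nat. n \<ge> 1 \<longrightarrow>
               norm (fold S [m..m + int n - 1] x) = norm (fold T [0..int n - 1] (V x))) \<and>
            (\<forall>x. \<forall>n::nat. n \<ge> 1 \<longrightarrow>
               norm (foldr (\<lambda>k. cadjoint (S k)) [m - int n..m - 1] x)
             = norm (foldr (\<lambda>k. cadjoint (T k)) [- int n..-1] (V x))))"
proof -
  have S: "bounded_op_family S" and T: "bounded_op_family T"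
    using assms(2,3) by (simp_all add: shift_weights_def)
  have bS: "bounded_clinear (S n)" and bT: "bounded_clinear (T n)" for n
    using S T by (simp_all add: bounded_op_family_def)
  let ?Sf = "\<lambda>n. S (m + int n)" and ?Tf = "\<lambda>n. T (int n)"
    and ?Sb = "\<lambda>n. cadjoint (S (m - int n - 1))" and ?Tb = "\<lambda>n. cadjoint (T (- int n - 1))"
  let ?U = "\<lambda>W. op_powi flat_shift (- m) \<circ> diagonal_op W"
  have folds: "fold S [m..m + int n - 1] = fold ?Sf [0..<n]"
    "fold T [0..int n - 1] = fold ?Tf [0..<n]"
    "foldr (\<lambda>k. cadjoint (S k)) [m - int n..m - 1] = fold ?Sb [0..<n]"
    "foldr (\<lambda>k. cadjoint (T k)) [- int n..-1] = fold ?Tb [0..<n]" for n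
    using fold_upto_conv_upt[of S m n] fold_upto_conv_upt[of T 0 n]
      foldr_upto_conv_upt[of "\<lambda>k. cadjoint (S k)" m n]
      foldr_upto_conv_upt[of "\<lambda>k. cadjoint (T k)" 0 n]
    by simp_all
  show ?thesis
    unfolding folds
  proof (intro iffI; elim exE conjE)
    fix U
    assume U: "unitary_op U" "diagonal_form U" "U \<circ> bilateral_shift S = bilateral_shift T \<circ> U"
      "matrix_entry U 0 m \<noteq> (\<lambda>_. 0)"
    obtain k W where W: "bounded_op_family W" and Uk: "U = op_powi flat_shift k \<circ> diagonal_op W"
      using U(2) by (auto simp: diagonal_form_def)
    \<comment> \<open>The entry at row 0 and column \<open>m\<close> vanishes unless
      \<open>0 = m + k\<close>.\<close>
    have k: "k = - m"
      using U(4) unfolding Uk matrix_entry_shifted_diagonal[OF W] by (auto split: if_splits)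
    have unitary: "unitary_op (W j)" for j
      using unitary_weights[OF W] U(1) by (simp add: Uk)
    have iso: "norm (W j x) = norm x" for j x
      using unitary by (simp add: unitary_op_iff)
    have inter: "W j \<circ> S j = T (j - m) \<circ> W (j - 1)" for j
      using U(3) unfolding Uk shifted_diagonal_intertwines_iff[OF W S T] by (simp add: k)
    have inter': "W (j - 1) \<circ> cadjoint (S j) = cadjoint (T (j - m)) \<circ> W j" for j
      using unitary unitary bS bT inter by (rule unitary_op_intertwine_adjoint)
    \<comment> \<open>At \<open>j = m + n\<close> the relation leads from \<open>W (j - 1)\<close>
      up to \<open>W j\<close>, so the chain starts at \<open>W (m - 1)\<close>.\<close>
    have "W (m - 1 + int (Suc n)) \<circ> ?Sf n = ?Tf n \<circ> W (m - 1 + int n)" for n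
      using inter[of "m + int n"] by (simp add: algebra_simps)
    note fold_fwd = intertwining_fold[of "\<lambda>n. W (m - 1 + int n)", OF this]
    have fwd: "norm (fold ?Sf [0..<n] x) = norm (fold ?Tf [0..<n] (W (m - 1) x))" for n x
      using fold_fwd[of n x] iso[of "m - 1 + int n" "fold ?Sf [0..<n] x"] by simp
    \<comment> \<open>At \<open>j = m - n - 1\<close> the adjoint relation leads from
      \<open>W j\<close> down to \<open>W (j - 1)\<close>, starting from the same
      \<open>W (m - 1)\<close>.\<close>
    have "W (m - 1 - int (Suc n)) \<circ> ?Sb n = ?Tb n \<circ> W (m - 1 - int n)" for n
      using inter'[of "m - int n - 1"] by (simp add: algebra_simps minus_diff_commute)
    note fold_bwd = intertwining_fold[of "\<lambda>n. W (m - 1 - int n)", OF this]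
    have bwd: "norm (fold ?Sb [0..<n] x) = norm (fold ?Tb [0..<n] (W (m - 1) x))" for n x
      using fold_bwd[of n x] iso[of "m - 1 - int n" "fold ?Sb [0..<n] x"] by simp
    show "\<exists>V. unitary_op V \<and>
        (\<forall>x. \<forall>n\<ge>1. norm (fold ?Sf [0..<n] x) = norm (fold ?Tf [0..<n] (V x))) \<and>
        (\<forall>x. \<forall>n\<ge>1. norm (fold ?Sb [0..<n] x) = norm (fold ?Tb [0..<n] (V x)))"
      using unitary fwd bwd by blast
  next
    fix V
    assume V: "unitary_op V"
      and fwd1: "\<forall>x. \<forall>n\<ge>1. norm (fold ?Sf [0..<n] x) = norm (fold ?Tf [0..<n] (V x))"
      and bwd1: "\<forall>x. \<forall>n\<ge>1. norm (fold ?Sb [0..<n] x) = norm (fold ?Tb [0..<n] (V x))"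
    \<comment> \<open>The added case \<open>n = 0\<close> is the isometry of
      \<open>V\<close>.\<close>
    have fwd: "norm (fold ?Sf [0..<n] x) = norm (fold ?Tf [0..<n] (V x))" for n x
      using fwd1 V by (cases n) (auto simp: unitary_op_iff simp del: upt_Suc)
    have bwd: "norm (fold ?Sb [0..<n] x) = norm (fold ?Tb [0..<n] (V x))" for n x
      using bwd1 V by (cases n) (auto simp: unitary_op_iff simp del: upt_Suc)
    obtain Q where Q: "Q 0 = V" "\<And>n. unitary_op (Q n)" "\<And>n. Q (Suc n) \<circ> ?Sf n = ?Tf n \<circ> Q n"
      by (rule intertwining_unitaries[of ?Sf ?Tf V]) (use bS bT assms(4,5) V fwd in blast)+
    obtain R where R: "R 0 = V" "\<And>n. unitary_op (R n)" "\<And>n. R (Suc n) \<circ> ?Sb n = ?Tb n \<circ> R n"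
      by (rule intertwining_unitaries[of ?Sb ?Tb V])
        (use bS bT assms(6,7) V bwd bounded_clinear_cadjoint in blast)+
    \<comment> \<open>The upward and downward chains are glued at \<open>m - 1\<close>, where both
      equal \<open>V\<close>.\<close>
    define W where "W j = (if j \<ge> m - 1 then Q (nat (j - (m - 1))) else R (nat (m - 1 - j)))" for j
    have unitary: "unitary_op (W j)" for j by (simp add: W_def Q R)
    have WQ: "W (m - 1 + int n) = Q n" for n by (simp add: W_def)
    have WR: "W (m - 1 - int n) = R n" for n by (cases n) (simp_all add: W_def Q R nat_add_distrib)
    have W: "bounded_op_family W" using unitary by (rule bounded_op_family_unitary)
    have inter: "W j \<circ> S j = T (j - m) \<circ> W (j - 1)" for j
    proof (cases "j \<ge> m")
      case True
      then obtain n where "j = m + int n" by (metis zle_iff_zadd)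
      then show ?thesis using Q(3)[of n] WQ[of n] WQ[of "Suc n"] by (simp add: algebra_simps)
    next
      case False
      then obtain n where j: "j = m - int n - 1"
        by (intro that[of "nat (m - j - 1)"]) simp
      \<comment> \<open>Below \<open>m\<close> the construction gives only the adjoint relation; a
        second adjoint recovers the one for the weights.\<close>
      have "R (Suc n) \<circ> cadjoint (S j) = cadjoint (T (j - m)) \<circ> R n"
        using R(3)[of n] by (simp add: j algebra_simps minus_diff_commute)
      from unitary_op_intertwine_adjoint[OF R(2) R(2) _ _ this]
      have "R n \<circ> S j = T (j - m) \<circ> R (Suc n)"
        by (simp add: bS bT bounded_clinear_cadjoint cadjoint_cadjoint)
      moreover have "W j = R n" "W (j - 1) = R (Suc n)"
        using WR[of n] WR[of "Suc n"] by (simp_all add: j algebra_simps)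
      ultimately show ?thesis by simp
    qed
    have "unitary_op (?U W)" by (rule unitary_shifted_diagonal[OF unitary])
    moreover have "diagonal_form (?U W)" unfolding diagonal_form_def using W by blast
    moreover have "?U W \<circ> bilateral_shift S = bilateral_shift T \<circ> ?U W"
      unfolding shifted_diagonal_intertwines_iff[OF W S T] using inter by simp
    \<comment> \<open>This entry is the isometry \<open>W m\<close>, which could vanish only on the
      zero space.\<close>
    moreover have "matrix_entry (?U W) 0 m \<noteq> (\<lambda>_. 0)"
    proof
      assume "matrix_entry (?U W) 0 m = (\<lambda>_. 0)"
      then have "W m h = 0" for h
        unfolding matrix_entry_shifted_diagonal[OF W] by (simp add: fun_eq_iff)
      then have "norm h = 0" for h :: 'h
        using unitary[of m] by (metis norm_zero unitary_op_iff)
      then show False using assms(1) by simp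
    qed
    ultimately show "\<exists>U. unitary_op U \<and> diagonal_form U \<and>
        U \<circ> bilateral_shift S = bilateral_shift T \<circ> U \<and> matrix_entry U 0 m \<noteq> (\<lambda>_. 0)"
      by blast
  qed
qed

end
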